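(* Let $N\geq 5$ and let $C_N^2$ be the graph with vertex set $\mathbb{Z}_N$ in which $u,v$ are adjacent iff $u-v\in\{\pm1,\pm2\}$ (mod $N$). For $l\in\{0,1,\dots,N-1\}$, let $h_N(0,l)$ be the expected hitting time from vertex $0$ to vertex $l$ of the simple random walk on $C_N^2$. Then \[ h_N(0,l)=\frac{2}{5}\left(l(N-l)+2N\frac{F_{l}F_{N-l}}{F_{N}}\right). \]
   Context: $F_i$ denotes the $i$-th Fibonacci number ($F_0=0$, $F_1=1$, $F_{i+1}=F_i+F_{i-1}$). The simple random walk moves from a vertex $u$ to each neighbour of $u$ with probability $1/\deg(u)$; the hitting time from $p$ to $q$ is the number of steps until the walk started at $p$ first reaches $q$ (so $h_N(0,0)=0$). *)

theory Defs
  imports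
    "HOL-Probability.Probability"
    "HOL-Number_Theory.Fib"
    "HOL-Number_Theory.Cong"
    "Graph_Theory.Pair_Digraph"
begin

text \<open>Undirected graphs are symmetric \<open>pair_pre_digraph\<close>s (locale \<open>pair_graph\<close>). \<open>pmf_of_set\<close> is
  the uniform distribution only on finite non-empty sets, so \<open>srw_step\<close> is meaningful at vertices
  of finite non-zero degree.\<close>

definition srw_step :: "'a pair_pre_digraph \<Rightarrow> 'a \<Rightarrow> 'a pmf" where
  "srw_step G u = pmf_of_set {v. (u, v) \<in> parcs G}"

text \<open>The conditional law of the \<open>n\<close>-th position given the past \<open>\<omega> 0, \<dots>, \<omega> (n - 1)\<close>; the
  trajectory measure is obtained from these kernels by the Ionescu-Tulcea theorem.\<close>

definition srw_kernel :: "'a pair_pre_digraph \<Rightarrow> 'a \<Rightarrow> nat \<Rightarrow> (nat \<Rightarrow> 'a) \<Rightarrow> 'a measure" where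
  "srw_kernel G p n \<omega> =
     measure_pmf (case n of 0 \<Rightarrow> return_pmf p | Suc m \<Rightarrow> srw_step G (\<omega> m))"

global_interpretation srw: Ionescu_Tulcea "srw_kernel G p" "\<lambda>_. count_space UNIV"
  for G :: "'a pair_pre_digraph" and p :: 'a
proof (rule Ionescu_Tulcea.intro)
  show "srw_kernel G p i \<in> PiM {0..<i} (\<lambda>_. count_space UNIV) \<rightarrow>\<^sub>M subprob_algebra (count_space UNIV)" for i
  proof (cases i)
    case 0
    then show ?thesis by (simp add: srw_kernel_def[abs_def] measure_pmf_in_subprob_algebra)
  next
    case (Suc m)
    have "(\<lambda>\<omega>. \<omega> m) \<in> PiM {0..<i} (\<lambda>_. count_space UNIV) \<rightarrow>\<^sub>M (count_space UNIV :: 'a measure)"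
      by (rule measurable_component_singleton) (simp add: Suc)
    moreover have "(\<lambda>u. measure_pmf (srw_step G u)) \<in> count_space UNIV \<rightarrow>\<^sub>M subprob_algebra (count_space UNIV)"
      by (simp add: measure_pmf_in_subprob_algebra)
    ultimately have "(\<lambda>\<omega>. measure_pmf (srw_step G (\<omega> m))) \<in> PiM {0..<i} (\<lambda>_. count_space UNIV) \<rightarrow>\<^sub>M subprob_algebra (count_space UNIV)"
      by (rule measurable_compose)
    then show ?thesis by (simp add: srw_kernel_def[abs_def] Suc)
  qed
  show "prob_space (srw_kernel G p i x)"
    if "x \<in> space (PiM {0..<i} (\<lambda>_. count_space UNIV))" for i and x :: "nat \<Rightarrow> 'a"
    by (simp add: srw_kernel_def prob_space_measure_pmf)
qed

definition srw :: "'a pair_pre_digraph \<Rightarrow> 'a \<Rightarrow> (nat \<Rightarrow> 'a) measure" where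
  "srw G p = srw.PF.lim G p"

lemma emeasure_srw_C:
  "emeasure (srw.C G p 0 n (\<lambda>_. undefined)) (PiE {0..<n} (\<lambda>i. {x i})) =
     (\<Prod>i<n. ennreal (pmf (case i of 0 \<Rightarrow> return_pmf p | Suc m \<Rightarrow> srw_step G (x m)) (x i)))"
proof (induction n)
  case 0
  then show ?case by (simp add: PiM_empty)
next
  case (Suc n)
  let ?M = "\<lambda>n. PiM {0..<n} (\<lambda>_. count_space UNIV) :: (nat \<Rightarrow> 'a) measure"
  let ?A = "\<lambda>n. PiE {0..<n} (\<lambda>i. {x i})"
  let ?C = "srw.C G p 0 n (\<lambda>_. undefined)"
  let ?q = "ennreal (pmf (case n of 0 \<Rightarrow> return_pmf p | Suc m \<Rightarrow> srw_step G (x m)) (x n))"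
  have A: "?A m \<in> sets (?M m)" for m
    by (intro sets_PiM_I_finite) auto
  have und: "(\<lambda>_. undefined) \<in> space (?M 0)"
    by (simp add: space_PiM)
  have sC: "space ?C = space (?M n)" "sets ?C = sets (?M n)"
    using srw.space_C[OF und, of G p n] srw.sets_C[OF und, of G p n] by simp_all
  have eP: "emeasure (srw.eP G p n \<omega>) (?A (Suc n)) = ?q * indicator (?A n) \<omega>"
    if \<omega>: "\<omega> \<in> space (?M n)" for \<omega>
  proof -
    have ext: "\<omega> \<in> extensional {0..<n}"
      using \<omega> by (simp add: space_PiM PiE_def)
    have "emeasure (srw.eP G p n \<omega>) (?A (Suc n)) =
        emeasure (srw_kernel G p n \<omega>) (fun_upd \<omega> n -` ?A (Suc n) \<inter> UNIV)"
      using srw.emeasure_eP[OF \<omega> A, of G p] by simp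
    also have "fun_upd \<omega> n -` ?A (Suc n) \<inter> UNIV = (if \<omega> \<in> ?A n then {x n} else {})"
      using ext by (auto simp: PiE_iff extensional_def less_Suc_eq split: if_splits)
    also have "emeasure (srw_kernel G p n \<omega>) \<dots> = ?q * indicator (?A n) \<omega>"
      by (cases n) (auto simp: srw_kernel_def emeasure_pmf_single PiE_iff split: split_indicator)
    finally show ?thesis .
  qed
  have "emeasure (srw.C G p 0 (Suc n) (\<lambda>_. undefined)) (?A (Suc n)) =
      (\<integral>\<^sup>+\<omega>. emeasure (srw.eP G p n \<omega>) (?A (Suc n)) \<partial>?C)"
    unfolding srw.C.simps
  proof (subst emeasure_bind[where N = "?M (Suc n)"])
    show "space ?C \<noteq> {}"
      by (simp add: sC space_PiM PiE_eq_empty_iff)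
    show "srw.eP G p (0 + n) \<in> ?C \<rightarrow>\<^sub>M subprob_algebra (?M (Suc n))"
      unfolding measurable_cong_sets[OF sC(2) refl] using srw.measurable_eP[of G p n] by simp
  qed (use A in simp_all)
  also have "\<dots> = (\<integral>\<^sup>+\<omega>. ?q * indicator (?A n) \<omega> \<partial>?C)"
    by (intro nn_integral_cong) (simp add: eP sC)
  also have "\<dots> = ?q * emeasure ?C (?A n)"
    using A by (intro nn_integral_cmult_indicator) (simp add: sC)
  finally show ?case
    by (simp add: Suc.IH mult.commute)
qed

text \<open>The finite-dimensional distributions, which characterise \<open>srw G p\<close> as the law of the walk
  started at \<open>p\<close>.\<close>

lemma emeasure_srw_cylinder:
  "emeasure (srw G p) {\<omega>. \<forall>i\<le>n. \<omega> i = x i} =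
     (if x 0 = p then \<Prod>i<n. ennreal (pmf (srw_step G (x i)) (x (Suc i))) else 0)"
proof -
  let ?M = "\<lambda>_::nat. count_space UNIV :: 'a measure"
  let ?J = "{0..<Suc n}" and ?A = "PiE {0..<Suc n} (\<lambda>i. {x i})"
  have A: "?A \<in> sets (PiM ?J ?M)"
    by (intro sets_PiM_I_finite) auto
  have "{\<omega>. \<forall>i\<le>n. \<omega> i = x i} = prod_emb UNIV ?M ?J ?A"
    by (auto simp: prod_emb_def space_PiM PiE_iff)
  then have "emeasure (srw G p) {\<omega>. \<forall>i\<le>n. \<omega> i = x i} = emeasure (srw.CI G p ?J) ?A"
    using srw.lim[OF _ A, of G p] by (simp add: srw_def)
  also have "\<dots> = emeasure (srw.C G p 0 (Suc n) (\<lambda>_. undefined)) (prod_emb ?J ?M ?J ?A)"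
    by (rule srw.emeasure_CI[OF _ A]) simp
  also have "prod_emb ?J ?M ?J ?A = ?A"
    using sets.sets_into_space[OF A] by (intro prod_emb_id) (auto simp: space_PiM)
  also have "emeasure (srw.C G p 0 (Suc n) (\<lambda>_. undefined)) ?A =
      (if x 0 = p then \<Prod>i<n. ennreal (pmf (srw_step G (x i)) (x (Suc i))) else 0)"
    unfolding emeasure_srw_C by (subst prod.lessThan_Suc_shift) auto
  finally show ?thesis .
qed

text \<open>The infimum of the empty set is \<open>\<infinity>\<close>, so walks that never reach \<open>q\<close> count as infinite.\<close>

definition hitting_time :: "'a \<Rightarrow> (nat \<Rightarrow> 'a) \<Rightarrow> enat" where
  "hitting_time q \<omega> = (INF n \<in> {n. \<omega> n = q}. enat n)"

definition expected_hitting_time :: "'a pair_pre_digraph \<Rightarrow> 'a \<Rightarrow> 'a \<Rightarrow> ennreal" where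
  "expected_hitting_time G p q = (\<integral>\<^sup>+ \<omega>. ennreal_of_enat (hitting_time q \<omega>) \<partial>srw G p)"

text \<open>\<open>\<int>/N\<int>\<close> is represented by the residues \<open>0, \<dots>, N - 1\<close>.\<close>

definition cycle_square :: "nat \<Rightarrow> int pair_pre_digraph" where
  "cycle_square N =
     \<lparr>pverts = {0..<int N},
      parcs = {(u, v). u \<in> {0..<int N} \<and> v \<in> {0..<int N} \<and>
                       (\<exists>d \<in> {1, -1, 2, -2}. [u - v = d] (mod int N))}\<rparr>"

lemma pair_graph_cycle_square:
  assumes "N \<ge> 5"
  shows "pair_graph (cycle_square N)"
proof -
  let ?adj = "\<lambda>u v. \<exists>d \<in> {1, -1, 2, -2}. [u - v = d] (mod int N)"
  have arc: "(u, v) \<in> parcs (cycle_square N) \<longleftrightarrow> u \<in> {0..<int N} \<and> v \<in> {0..<int N} \<and> ?adj u v"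
    for u v
    by (simp only: cycle_square_def pair_pre_digraph.select_convs mem_Collect_eq case_prod_conv)
  have verts: "pverts (cycle_square N) = {0..<int N}"
    by (simp only: cycle_square_def pair_pre_digraph.select_convs)
  have adj_sym: "?adj v u" if "?adj u v" for u v
    using that
  proof (rule bexE)
    fix d assume d: "d \<in> {1, -1, 2, -2::int}" "[u - v = d] (mod int N)"
    have "[- (u - v) = - d] (mod int N)"
      by (rule cong_minus_minus_iff[THEN iffD2, OF d(2)])
    then have "[v - u = - d] (mod int N)"
      by (simp only: minus_diff_eq)
    moreover have "- d \<in> {1, -1, 2, -2}"
      using d(1) by auto
    ultimately show ?thesis by (rule bexI)
  qed
  have loop: "\<not> ?adj u u" for u
  proof
    assume "?adj u u"
    then show False
    proof (rule bexE)
      fix d assume d: "d \<in> {1, -1, 2, -2::int}" "[u - u = d] (mod int N)"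
      have "int N dvd \<bar>d\<bar>"
        using d(2) by (simp only: cong_iff_dvd_diff diff_self diff_0 dvd_minus_iff dvd_abs_iff)
      moreover have "0 < \<bar>d\<bar>" "\<bar>d\<bar> \<le> 2"
        using d(1) by auto
      ultimately have "int N \<le> 2"
        using zdvd_imp_le order_trans by metis
      then show False
        using assms by linarith
    qed
  qed
  have arcD: "u \<in> {0..<int N}" "v \<in> {0..<int N}" "u \<noteq> v" if "(u, v) \<in> parcs (cycle_square N)" for u v
  proof -
    note * = that[unfolded arc]
    show "u \<in> {0..<int N}" by (rule conjunct1[OF *])
    show "v \<in> {0..<int N}" by (rule conjunct1[OF conjunct2[OF *]])
    show "u \<noteq> v"
    proof
      assume "u = v"
      with conjunct2[OF conjunct2[OF *]] have "?adj v v" by (simp only:)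
      with loop show False by (rule notE)
    qed
  qed
  have sub: "parcs (cycle_square N) \<subseteq> {0..<int N} \<times> {0..<int N}"
    by (rule subrelI) (rule SigmaI arcD | assumption)+
  then have fin: "finite (parcs (cycle_square N))"
    by (rule finite_subset) simp
  have "sym (parcs (cycle_square N))"
  proof (rule symI)
    fix u v assume "(u, v) \<in> parcs (cycle_square N)"
    note * = this[unfolded arc]
    show "(v, u) \<in> parcs (cycle_square N)"
      unfolding arc
      by (rule conjI[OF conjunct1[OF conjunct2[OF *]]
            conjI[OF conjunct1[OF *] adj_sym[OF conjunct2[OF conjunct2[OF *]]]]])
  qed
  then have symm: "symmetric (with_proj (cycle_square N))"
    by (simp only: symmetric_def with_proj_simps)
  show ?thesis
  proof
    show "fst e \<in> pverts (cycle_square N)" "snd e \<in> pverts (cycle_square N)" "fst e \<noteq> snd e"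
      if "e \<in> parcs (cycle_square N)" for e
      using arcD[of "fst e" "snd e", unfolded prod.collapse, OF that] by (simp_all only: verts not_False_eq_True)
    show "finite (pverts (cycle_square N))"
      by (simp only: verts finite_atLeastLessThan_int)
  qed (fact fin symm)+
qed

end

(* If g(q) = 0 and g is one plus its neighbour average away from q, then the stopped values
   E[g(X_n); T > n] drop by exactly P(T > n) at each step. As g is bounded, these probabilities are
   summable, the stopped values tend to 0, and telescoping gives E T = g(p). It remains to verify
   that the claimed formula satisfies the recurrence: the quadratic term contributes the constant
   and the product F_d F_{N-d} is harmonic. The arguments d = -1 and d = N + 1, where the recurrence
   at d = 1 and d = N - 1 wraps around the cycle, are covered by setting F_{-1} = 1, since the
   formula is N-periodic there. *)
theory Submission
  imports Defs
begin

section \<open>Path laws as discrete distributions\<close>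

text \<open>Lists grow at the end, so one more step of the walk is a single \<open>bind_pmf\<close>
  and conditioning on the past stays discrete.\<close>

primrec path_pmf :: "'a pair_pre_digraph \<Rightarrow> 'a \<Rightarrow> nat \<Rightarrow> 'a list pmf" where
  "path_pmf G p 0 = return_pmf [p]"
| "path_pmf G p (Suc n) =
     bind_pmf (path_pmf G p n) (\<lambda>xs. map_pmf (\<lambda>v. xs @ [v]) (srw_step G (last xs)))"

lemma length_path_pmf: "xs \<in> set_pmf (path_pmf G p n) \<Longrightarrow> length xs = Suc n"
  by (induction n arbitrary: xs) auto

lemma set_path_pmf_subset:
  assumes "p \<in> V" "\<And>u. u \<in> V \<Longrightarrow> set_pmf (srw_step G u) \<subseteq> V"
  shows "xs \<in> set_pmf (path_pmf G p n) \<Longrightarrow> set xs \<subseteq> V"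
proof (induction n arbitrary: xs)
  case 0
  then show ?case using assms by simp
next
  case (Suc n)
  then obtain ys v where ys: "ys \<in> set_pmf (path_pmf G p n)" "v \<in> set_pmf (srw_step G (last ys))"
    and xs: "xs = ys @ [v]" by auto
  have "ys \<noteq> []" using length_path_pmf[OF ys(1)] by auto
  then have "last ys \<in> V" using Suc.IH[OF ys(1)] last_in_set by blast
  then show ?case using assms(2) ys Suc.IH[OF ys(1)] xs by auto
qed

text \<open>Has the right-hand side of \<open>emeasure_srw_cylinder\<close>, so the two laws can be
  compared pointwise.\<close>

lemma pmf_path_pmf:
  "ennreal (pmf (path_pmf G p n) (map x [0..<Suc n])) =
     (if x 0 = p then \<Prod>i<n. ennreal (pmf (srw_step G (x i)) (x (Suc i))) else 0)"
proof (induction n)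
  case 0
  then show ?case by (simp add: indicator_def)
next
  case (Suc n)
  define ys where "ys = map x [0..<Suc n]"
  have last: "last ys = x n" by (simp add: ys_def)
  have inj: "inj (\<lambda>v. ys @ [v])" by (simp add: inj_def)
  \<comment> \<open>Only the prefix \<open>ys\<close> extends to \<open>ys @ [x (Suc n)]\<close>, so
    the integrand of the bind lives on one point.\<close>
  have *: "ennreal (pmf (map_pmf (\<lambda>v. xs @ [v]) (srw_step G (last xs))) (ys @ [x (Suc n)])) =
      ennreal (pmf (srw_step G (x n)) (x (Suc n))) * indicator {ys} xs" for xs
  proof (cases "xs = ys")
    case True
    then show ?thesis
      using pmf_map_inj'[OF inj, of "srw_step G (x n)" "x (Suc n)"] by (simp add: last)
  next
    case False
    then have "ys @ [x (Suc n)] \<notin> set_pmf (map_pmf (\<lambda>v. xs @ [v]) (srw_step G (last xs)))"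
      by auto
    then have "pmf (map_pmf (\<lambda>v. xs @ [v]) (srw_step G (last xs))) (ys @ [x (Suc n)]) = 0"
      by (rule pmf_eq_0_set_pmf[THEN iffD2])
    then show ?thesis using False by simp
  qed
  have "ennreal (pmf (path_pmf G p (Suc n)) (ys @ [x (Suc n)])) =
      ennreal (pmf (srw_step G (x n)) (x (Suc n))) * ennreal (pmf (path_pmf G p n) ys)"
    unfolding path_pmf.simps ennreal_pmf_bind *
    by (subst nn_integral_cmult_indicator) (simp_all add: emeasure_pmf_single)
  moreover have "map x [0..<Suc (Suc n)] = ys @ [x (Suc n)]"
    by (simp add: ys_def)
  ultimately show ?case
    using Suc.IH unfolding ys_def[symmetric]
    by (simp add: mult.commute del: path_pmf.simps upt_Suc)
qed

section \<open>Prefixes of the trajectory measure\<close>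

lemma sets_srw: "sets (srw G p) = sets (PiM UNIV (\<lambda>_. count_space UNIV))"
  by (simp add: srw_def)

lemma space_srw: "space (srw G p) = UNIV"
  by (simp add: srw_def space_PiM)

lemma pred_srw_component_eq [measurable]: "Measurable.pred (srw G p) (\<lambda>\<omega>. \<omega> i = x)"
proof -
  have "(\<lambda>\<omega>. \<omega> i) \<in> srw G p \<rightarrow>\<^sub>M count_space UNIV"
    unfolding measurable_cong_sets[OF sets_srw refl] by simp
  then show ?thesis by (rule measurable_compose) simp
qed

text \<open>Lists over a countable type are countable, so singletons suffice; their preimages are
  cut out by finitely many coordinate conditions.\<close>

lemma measurable_srw_prefix:
  "(\<lambda>\<omega>. map \<omega> [0..<m]) \<in> srw G p \<rightarrow>\<^sub>M (count_space UNIV :: 'a::countable list measure)"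
proof (intro measurable_count_space_eq_countable[THEN iffD2] conjI ballI)
  fix xs :: "'a list"
  have "map \<omega> [0..<m] = xs \<longleftrightarrow> length xs = m \<and> (\<forall>i<m. \<omega> i = xs ! i)" for \<omega>
    by (subst list_eq_iff_nth_eq) auto
  then have "(\<lambda>\<omega>. map \<omega> [0..<m]) -` {xs} \<inter> space (srw G p) =
      {\<omega> \<in> space (srw G p). length xs = m \<and> (\<forall>i<m. \<omega> i = xs ! i)}"
    by auto
  also have "\<dots> \<in> sets (srw G p)" by measurable
  finally show "(\<lambda>\<omega>. map \<omega> [0..<m]) -` {xs} \<inter> space (srw G p) \<in> sets (srw G p)" .
qed auto

text \<open>On a countable space singletons decide. There the cylinder formula matches
  \<open>pmf_path_pmf\<close>, and lists of the wrong length have mass 0 on both sides.\<close>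

lemma distr_srw_prefix:
  fixes G :: "'a::countable pair_pre_digraph"
  shows "distr (srw G p) (count_space UNIV) (\<lambda>\<omega>. map \<omega> [0..<Suc n]) = measure_pmf (path_pmf G p n)"
proof (rule measure_eqI_countable[where A = UNIV])
  fix xs :: "'a list"
  let ?D = "distr (srw G p) (count_space UNIV) (\<lambda>\<omega>. map \<omega> [0..<Suc n])"
  have D: "emeasure ?D {xs} = emeasure (srw G p) {\<omega>. map \<omega> [0..<Suc n] = xs}"
    by (subst emeasure_distr[OF measurable_srw_prefix]) (auto simp: space_srw vimage_def)
  show "emeasure ?D {xs} = emeasure (measure_pmf (path_pmf G p n)) {xs}"
  proof (cases "length xs = Suc n")
    case True
    then have xs: "map ((!) xs) [0..<Suc n] = xs" by (metis map_nth)
    have "{\<omega>. map \<omega> [0..<Suc n] = xs} = {\<omega>. \<forall>i\<le>n. \<omega> i = xs ! i}"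
      using True by (auto simp: list_eq_iff_nth_eq less_Suc_eq_le simp del: upt_Suc)
    then show ?thesis
      using pmf_path_pmf[of G p n "(!) xs"] emeasure_srw_cylinder[of G p n "(!) xs"]
      unfolding D xs by (simp add: emeasure_pmf_single)
  next
    case False
    then have "{\<omega>. map \<omega> [0..<Suc n] = xs} = {}" by auto
    moreover have "pmf (path_pmf G p n) xs = 0"
      using False length_path_pmf by (metis pmf_eq_0_set_pmf)
    ultimately show ?thesis unfolding D by (simp add: emeasure_pmf_single)
  qed
qed auto

section \<open>Hitting time as a sum of tails\<close>

lemma hitting_time_conv_Least:
  "hitting_time q \<omega> = (if \<exists>n. \<omega> n = q then enat (LEAST n. \<omega> n = q) else \<infinity>)"
proof (cases "\<exists>n. \<omega> n = q")
  case True
  then have "hitting_time q \<omega> = enat (LEAST n. \<omega> n = q)"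
    unfolding hitting_time_def by (intro antisym INF_lower INF_greatest)
      (auto intro: LeastI_ex Least_le)
  then show ?thesis using True by simp
next
  case False
  then show ?thesis by (simp add: hitting_time_def top_enat_def)
qed

text \<open>The event T > n depends on positions 0, ..., n only, hence \<open>Suc n\<close> entries;
  this reduces tails to path laws.\<close>

lemma less_hitting_time_iff: "enat n < hitting_time q \<omega> \<longleftrightarrow> q \<notin> set (map \<omega> [0..<Suc n])"
proof -
  have "enat n < hitting_time q \<omega> \<longleftrightarrow> (\<forall>i\<le>n. \<omega> i \<noteq> q)"
  proof (cases "\<exists>n. \<omega> n = q")
    case True
    then have "\<omega> (LEAST n. \<omega> n = q) = q" by (rule LeastI_ex)
    then have "\<not> (\<forall>i\<le>n. \<omega> i \<noteq> q)" if "\<not> n < (LEAST n. \<omega> n = q)"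
      using that not_less by blast
    moreover have "\<omega> i \<noteq> q" if "n < (LEAST n. \<omega> n = q)" "i \<le> n" for i
      by (rule not_less_Least) (rule le_less_trans[OF that(2,1)])
    ultimately have "n < (LEAST n. \<omega> n = q) \<longleftrightarrow> (\<forall>i\<le>n. \<omega> i \<noteq> q)"
      by blast
    then show ?thesis using True by (simp add: hitting_time_conv_Least)
  next
    case False
    then show ?thesis by (simp add: hitting_time_conv_Least)
  qed
  also have "\<dots> \<longleftrightarrow> q \<notin> set (map \<omega> [0..<Suc n])"
    unfolding set_map set_upt by (auto simp: less_Suc_eq_le)
  finally show ?thesis .
qed

text \<open>The tail-sum formula holds for every measurable time with values in the extended
  naturals, so almost sure hitting is not presupposed; each tail is read off the prefix law.\<close>

lemma expected_hitting_time_suminf: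
  fixes G :: "'a::countable pair_pre_digraph"
  shows "expected_hitting_time G p q = (\<Sum>n. emeasure (path_pmf G p n) {xs. q \<notin> set xs})"
proof -
  have "hitting_time q \<in> srw G p \<rightarrow>\<^sub>M count_space UNIV"
    unfolding hitting_time_conv_Least[abs_def] by measurable
  then have "expected_hitting_time G p q =
      (\<Sum>n. emeasure (srw G p) {\<omega> \<in> space (srw G p). enat n < hitting_time q \<omega>})"
    unfolding expected_hitting_time_def by (rule nn_integral_enat_function)
  also have "\<dots> = (\<Sum>n. emeasure (path_pmf G p n) {xs. q \<notin> set xs})"
  proof (rule suminf_cong)
    fix n
    have "{\<omega> \<in> space (srw G p). enat n < hitting_time q \<omega>} =
        (\<lambda>\<omega>. map \<omega> [0..<Suc n]) -` {xs. q \<notin> set xs} \<inter> space (srw G p)"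
      unfolding less_hitting_time_iff by auto
    then show "emeasure (srw G p) {\<omega> \<in> space (srw G p). enat n < hitting_time q \<omega>} =
        emeasure (path_pmf G p n) {xs. q \<notin> set xs}"
      using emeasure_distr[OF measurable_srw_prefix, of "{xs. q \<notin> set xs}" G p "Suc n"]
      unfolding distr_srw_prefix by simp
  qed
  finally show ?thesis .
qed

section \<open>Potential criterion for the expected hitting time\<close>

text \<open>\<open>V\<close> confines the recurrence to a set the walk cannot leave, since
  \<open>srw_step\<close> carries no meaning where there are no neighbours. Values in
  \<open>ennreal\<close> avoid integrability conditions; \<open>B\<close> supplies
  finiteness.\<close>

theorem expected_hitting_time_eqI:
  fixes G :: "'a::countable pair_pre_digraph" and g :: "'a \<Rightarrow> ennreal"
  assumes p: "p \<in> V" and closed: "\<And>u. u \<in> V \<Longrightarrow> set_pmf (srw_step G u) \<subseteq> V"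
    and bound: "\<And>u. u \<in> V \<Longrightarrow> g u \<le> ennreal B"
    and g_q: "g q = 0"
    and g_step: "\<And>u. u \<in> V \<Longrightarrow> u \<noteq> q \<Longrightarrow> g u = 1 + (\<integral>\<^sup>+v. g v \<partial>srw_step G u)"
  shows "expected_hitting_time G p q = g p"
proof -
  \<comment> \<open>With T the hitting time of \<open>q\<close>, \<open>P n\<close> is P(T > n) and
    \<open>e n\<close> is the stopped value E[g(X_n); T > n].\<close>
  define P where "P n = emeasure (path_pmf G p n) {xs. q \<notin> set xs}" for n
  define e where "e n = (\<integral>\<^sup>+xs. g (last xs) * indicator {xs. q \<notin> set xs} xs \<partial>path_pmf G p n)" for n
  have path: "xs \<noteq> []" "last xs \<in> V" if "xs \<in> set_pmf (path_pmf G p n)" for xs n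
  proof -
    show "xs \<noteq> []" using length_path_pmf[OF that] by auto
    then show "last xs \<in> V"
      using set_path_pmf_subset[OF p closed that] last_in_set by blast
  qed
  have e_Suc: "e n = P n + e (Suc n)" for n
  proof -
    have "g (last xs) * indicator {xs. q \<notin> set xs} xs =
        indicator {xs. q \<notin> set xs} xs +
        (\<integral>\<^sup>+v. g v * indicator {xs. q \<notin> set xs} (xs @ [v]) \<partial>srw_step G (last xs))"
      if "xs \<in> set_pmf (path_pmf G p n)" for xs
    proof (cases "q \<in> set xs")
      case False
      have "g v * indicator {xs. q \<notin> set xs} (xs @ [v]) = g v" for v
        using False g_q by (auto split: split_indicator)
      moreover have "last xs \<noteq> q" using False path(1)[OF that] last_in_set by metis
      ultimately show ?thesis using g_step[OF path(2)[OF that]] False by simp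
    qed simp
    then have "e n = (\<integral>\<^sup>+xs. indicator {xs. q \<notin> set xs} xs +
        (\<integral>\<^sup>+v. g v * indicator {xs. q \<notin> set xs} (xs @ [v]) \<partial>srw_step G (last xs)) \<partial>path_pmf G p n)"
      unfolding e_def by (intro nn_integral_cong_AE) (simp add: AE_measure_pmf_iff)
    also have "\<dots> = P n + e (Suc n)"
      unfolding P_def e_def by (subst nn_integral_add) simp_all
    finally show ?thesis .
  qed
  have sum: "(\<Sum>k<n. P k) + e n = g p" for n
  proof (induction n)
    case 0
    \<comment> \<open>The indicator fails only when \<open>p = q\<close>, and then
      \<open>g p = 0\<close> as well.\<close>
    then show ?case using g_q by (auto simp: e_def split: split_indicator)
  next
    case (Suc n)
    then show ?case by (simp add: e_Suc[of n] ac_simps)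
  qed
  have P_sums: "(\<lambda>n. \<Sum>k<n. P k) \<longlonglongrightarrow> (\<Sum>n. P n)"
    by (rule summable_LIMSEQ) simp
  have P_real: "P n = ennreal (measure (path_pmf G p n) {xs. q \<notin> set xs})" for n
    unfolding P_def by (simp add: measure_pmf.emeasure_eq_measure)
  have "(\<Sum>n. P n) \<le> g p"
    using sum by (intro LIMSEQ_le_const2[OF P_sums]) (metis le_iff_add)
  also have "g p < \<infinity>" using bound[OF p] le_less_trans by fastforce
  finally have "(\<Sum>n. P n) \<noteq> top" by auto
  \<comment> \<open>Summability of the real probabilities makes them tend to 0;
    \<open>B * P n\<close> then dominates \<open>e n\<close>.\<close>
  then have "summable (\<lambda>n. measure (path_pmf G p n) {xs. q \<notin> set xs})"
    unfolding P_real by (intro summable_suminf_not_top) simp_all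
  then have "(\<lambda>n. ennreal B * P n) \<longlonglongrightarrow> ennreal B * ennreal 0"
    unfolding P_real by (intro ennreal_tendsto_cmult tendsto_ennrealI summable_LIMSEQ_zero) simp_all
  moreover have "e n \<le> ennreal B * P n" for n
  proof -
    have "e n \<le> (\<integral>\<^sup>+xs. ennreal B * indicator {xs. q \<notin> set xs} xs \<partial>path_pmf G p n)"
      unfolding e_def using bound path(2)
      by (intro nn_integral_mono_AE) (auto simp: AE_measure_pmf_iff split: split_indicator)
    then show ?thesis by (simp add: nn_integral_cmult P_def)
  qed
  ultimately have "e \<longlonglongrightarrow> 0"
    by (intro tendsto_sandwich[of "\<lambda>_. 0" e sequentially "\<lambda>n. ennreal B * P n"]) simp_all
  then have "(\<lambda>n. (\<Sum>k<n. P k) + e n) \<longlonglongrightarrow> (\<Sum>n. P n) + 0"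
    using P_sums by (intro tendsto_add)
  then have "(\<Sum>n. P n) = g p"
    unfolding sum by (simp add: LIMSEQ_const_iff)
  then show ?thesis
    unfolding expected_hitting_time_suminf P_def .
qed

section \<open>One step on the squared cycle\<close>

lemma neighbours_cycle_square:
  assumes "N \<ge> 5" "u \<in> {0..<int N}"
  shows "{v. (u, v) \<in> parcs (cycle_square N)} = (\<lambda>d. (u - d) mod int N) ` {1, -1, 2, -2}"
proof -
  have "(u, v) \<in> parcs (cycle_square N) \<longleftrightarrow>
      (\<exists>d\<in>{1, -1, 2, -2}. v = (u - d) mod int N)" for v
  proof -
    have "v \<in> {0..<int N} \<and> [u - v = d] (mod int N) \<longleftrightarrow> v = (u - d) mod int N" for d
    proof -
      have "[u - v = d] (mod int N) \<longleftrightarrow> [v = u - d] (mod int N)"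
        unfolding cong_iff_dvd_diff using dvd_minus_iff[of "int N" "u - v - d"]
        by (simp add: algebra_simps)
      then show ?thesis using assms(1) by (auto simp: cong_def)
    qed
    moreover have "(u, v) \<in> parcs (cycle_square N) \<longleftrightarrow> u \<in> {0..<int N} \<and> v \<in> {0..<int N} \<and>
        (\<exists>d\<in>{1, -1, 2, -2}. [u - v = d] (mod int N))"
      by (simp only: cycle_square_def pair_pre_digraph.select_convs mem_Collect_eq case_prod_conv)
    ultimately show ?thesis using assms(2) by metis
  qed
  then show ?thesis by auto
qed

text \<open>Two offsets differ by at most 4 < N, so \<open>N \<ge> 5\<close> makes the degree
  exactly 4.\<close>

lemma inj_on_cycle_square_shift:
  assumes "N \<ge> 5"
  shows "inj_on (\<lambda>d. (u - d) mod int N) {1, -1, 2, -2}"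
proof (rule inj_onI)
  fix d d' :: int
  assume d: "d \<in> {1, -1, 2, -2}" "d' \<in> {1, -1, 2, -2}" and "(u - d) mod int N = (u - d') mod int N"
  then have "int N dvd (u - d) - (u - d')"
    by (simp only: mod_eq_dvd_iff)
  then have "int N dvd (d' - d)" by simp
  show "d = d'"
  proof (rule ccontr)
    assume "d \<noteq> d'"
    then have "\<bar>int N\<bar> \<le> \<bar>d' - d\<bar>"
      using \<open>int N dvd (d' - d)\<close> by (intro dvd_imp_le_int) auto
    moreover have "\<bar>d' - d\<bar> \<le> 4" using d by auto
    ultimately show False using assms by linarith
  qed
qed

lemma nn_integral_srw_step_cycle_square:
  assumes "N \<ge> 5" "u \<in> {0..<int N}"
  shows "(\<integral>\<^sup>+v. f v \<partial>srw_step (cycle_square N) u) =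
    (\<Sum>d\<in>{1, -1, 2, -2}. f ((u - d) mod int N)) / 4"
proof -
  let ?S = "(\<lambda>d. (u - d) mod int N) ` {1, -1, 2, -2}"
  have "card ?S = 4"
    using inj_on_cycle_square_shift[OF assms(1)] by (subst card_image) auto
  moreover have "sum f ?S = (\<Sum>d\<in>{1, -1, 2, -2}. f ((u - d) mod int N))"
    using inj_on_cycle_square_shift[OF assms(1)] by (subst sum.reindex) (auto simp: o_def)
  moreover have "(\<integral>\<^sup>+v. f v \<partial>pmf_of_set ?S) = sum f ?S / of_nat (card ?S)"
    by (subst nn_integral_pmf_of_set) auto
  ultimately show ?thesis
    unfolding srw_step_def neighbours_cycle_square[OF assms] by simp
qed

section \<open>The claimed formula on the integers\<close>

text \<open>Only \<open>k \<ge> -1\<close> is meaningful; other negative arguments yield \<open>0\<close>.\<close>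

definition fib_int :: "int \<Rightarrow> real" where
  "fib_int k = (if k = -1 then 1 else real (fib (nat k)))"

text \<open>At k = 0 this is F_1 = F_0 + F_{-1}, which dictates the value 1 at -1.\<close>

lemma fib_int_rec: "k \<ge> 0 \<Longrightarrow> fib_int (k + 1) = fib_int k + fib_int (k - 1)"
proof -
  assume "k \<ge> 0"
  then consider "k = 0" | n where "k = int (Suc n)"
    by (metis nat_0_le not0_implies_Suc of_nat_0)
  then show ?thesis
  proof cases
    case 2
    then have "nat (k + 1) = Suc (Suc n)" "nat k = Suc n" "nat (k - 1) = n" by auto
    then show ?thesis using 2 by (simp add: fib_int_def)
  qed (simp add: fib_int_def)
qed

text \<open>The argument is the displacement from the current vertex to the target, an integer so
  that -1 and N + 1 are admissible.\<close>

definition cycle_hit :: "nat \<Rightarrow> int \<Rightarrow> real" where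
  "cycle_hit N d = 2 / 5 * (of_int d * (real N - of_int d)
     + 2 * real N * (fib_int d * fib_int (int N - d) / fib_int (int N)))"

lemma fib_int_of_nat_pos: "N > 0 \<Longrightarrow> fib_int (int N) > 0"
  by (simp add: fib_int_def fib_neq_0_nat)

lemma cycle_hit_nonneg: "0 \<le> d \<Longrightarrow> d \<le> int N \<Longrightarrow> cycle_hit N d \<ge> 0"
  unfolding cycle_hit_def
  by (intro mult_nonneg_nonneg add_nonneg_nonneg divide_nonneg_nonneg) (auto simp: fib_int_def)

text \<open>In the quadratic part the terms linear in k cancel and the squares contribute -(1 + 1 +
  4 + 4) = -10; the factor 2/5 turns this into -4.\<close>

lemma cycle_hit_harmonic:
  assumes "0 < d" "d < int N"
  shows "4 * cycle_hit N d = 4 + (\<Sum>k\<in>{1, -1, 2, -2}. cycle_hit N (d + k))"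
proof -
  define m where "m = int N - d"
  define P where "P k = fib_int (d + k) * fib_int (m - k)" for k
  \<comment> \<open>As d, m >= 1, the smallest argument is -1, still covered by the extended
    recurrence.\<close>
  have r: "fib_int (d + 1) = fib_int d + fib_int (d - 1)"
    "fib_int (d + 2) = fib_int (d + 1) + fib_int d"
    "fib_int d = fib_int (d - 1) + fib_int (d - 2)"
    "fib_int (m + 1) = fib_int m + fib_int (m - 1)"
    "fib_int (m + 2) = fib_int (m + 1) + fib_int m"
    "fib_int m = fib_int (m - 1) + fib_int (m - 2)"
    using fib_int_rec[of d] fib_int_rec[of "d + 1"] fib_int_rec[of "d - 1"]
      fib_int_rec[of m] fib_int_rec[of "m + 1"] fib_int_rec[of "m - 1"] assms
    by (simp_all add: m_def algebra_simps)
  have "P 1 + P (-1) + P 2 + P (-2) = 4 * P 0"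
  proof -
    \<comment> \<open>Expressed through the values at d, d - 1, m and m - 1, all products but
      \<open>fib_int d * fib_int m\<close> cancel.\<close>
    have r': "fib_int (d + 1) = fib_int d + fib_int (d - 1)"
      "fib_int (d + 2) = 2 * fib_int d + fib_int (d - 1)"
      "fib_int (d - 2) = fib_int d - fib_int (d - 1)"
      "fib_int (m + 1) = fib_int m + fib_int (m - 1)"
      "fib_int (m + 2) = 2 * fib_int m + fib_int (m - 1)"
      "fib_int (m - 2) = fib_int m - fib_int (m - 1)"
      using r by linarith+
    show ?thesis unfolding P_def by (simp add: r') (simp add: algebra_simps)
  qed
  moreover have "cycle_hit N (d + k) = 2 / 5 * ((of_int d + of_int k) * (real N - of_int d - of_int k))
      + 4 / 5 * real N / fib_int (int N) * P k" for k
  proof -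
    have "2 / 5 * (x + 2 * y * (a / b)) = 2 / 5 * x + 4 / 5 * y / b * a" for x y a b :: real
      by (simp add: algebra_simps)
    then show ?thesis
      unfolding cycle_hit_def P_def m_def by (simp only: of_int_add diff_diff_eq)
  qed
  note this[of 1] this[of "-1"] this[of 2] this[of "-2"] this[of 0]
  moreover have "(\<Sum>k\<in>{1, -1, 2, -2}. cycle_hit N (d + k)) =
      cycle_hit N (d + 1) + cycle_hit N (d + -1) + cycle_hit N (d + 2) + cycle_hit N (d + -2)"
    by simp
  ultimately show ?thesis by simp algebra
qed

text \<open>Neither summand is periodic by itself. Up to the factor 2/5, the shift changes the
  quadratic one by -2kN and, since F_{N+1} - F_{N-1} = F_N, the product term by 2kN; the weight 2N
  is what balances them.\<close>

lemma cycle_hit_periodic: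
  assumes "N > 0" "k \<in> {-1, 0, 1}"
  shows "cycle_hit N (k + int N) = cycle_hit N k"
proof -
  have f: "fib_int (-1) = 1" "fib_int 0 = 0" "fib_int 1 = 1"
    by (simp_all add: fib_int_def)
  have "fib_int (int N) > 0" using fib_int_of_nat_pos assms by simp
  moreover have "fib_int (int N + 1) = fib_int (int N) + fib_int (int N - 1)"
    by (rule fib_int_rec) simp
  ultimately show ?thesis
    using assms(2) f by (auto simp: cycle_hit_def field_simps)
qed

text \<open>The range is what 0 < d < N can reach with an offset of absolute value at most
  2.\<close>

lemma cycle_hit_mod:
  assumes "N > 1" "-1 \<le> d" "d \<le> int N + 1"
  shows "cycle_hit N (d mod int N) = cycle_hit N d"
proof -
  consider "0 \<le> d" "d < int N" | "d = -1" | "d = 0 + int N" | "d = 1 + int N"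
    using assms by linarith
  then show ?thesis
  proof cases
    case 2
    then show ?thesis
      using cycle_hit_periodic[of N "-1"] assms zmod_minus1[of "int N"] by simp
  next
    case 3
    then show ?thesis using cycle_hit_periodic[of N 0] assms by simp
  next
    case 4
    then show ?thesis using cycle_hit_periodic[of N 1] assms by simp
  qed simp
qed

section \<open>Application of the criterion\<close>

theorem theorem1p2:
  fixes N l :: nat
  assumes "N \<ge> 5" and "l \<in> {0..N - 1}"
  shows "expected_hitting_time (cycle_square N) 0 (int l) =
    ennreal (2 / 5 * (real l * (real N - real l)
      + 2 * real N * (real (fib l) * real (fib (N - l)) / real (fib N))))"
proof -
  \<comment> \<open>The recurrence involves all starting vertices; by rotation symmetry only the
    displacement to the target matters.\<close>
  define g where "g u = ennreal (cycle_hit N ((int l - u) mod int N))" for u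
  let ?V = "{0..<int N}"
  have N: "int N > 0" and l: "int l < int N" using assms by auto
  have "expected_hitting_time (cycle_square N) 0 (int l) = g 0"
  proof (rule expected_hitting_time_eqI[where V = ?V and B = "Max (cycle_hit N ` ?V)"])
    show "0 \<in> ?V" using N by simp
    show "set_pmf (srw_step (cycle_square N) u) \<subseteq> ?V" if "u \<in> ?V" for u
      unfolding srw_step_def neighbours_cycle_square[OF assms(1) that] using N by auto
    show "g u \<le> ennreal (Max (cycle_hit N ` ?V))" for u
      unfolding g_def using N by (intro ennreal_leI Max_ge) auto
    show "g (int l) = 0"
      by (simp add: g_def cycle_hit_def fib_int_def)
    show "g u = 1 + (\<integral>\<^sup>+v. g v \<partial>srw_step (cycle_square N) u)" if u: "u \<in> ?V" "u \<noteq> int l" for u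
    proof -
      define d where "d = (int l - u) mod int N"
      \<comment> \<open>Distinct residues differ by less than N, so the displacement is nonzero mod
        N and the harmonic identity applies.\<close>
      have "\<not> int N dvd (int l - u)"
        using u l dvd_imp_le_int[of "int l - u" "int N"] by auto
      then have d: "0 < d" "d < int N"
        using pos_mod_sign[OF N, of "int l - u"] pos_mod_bound[OF N, of "int l - u"]
        unfolding d_def dvd_eq_mod_eq_0 by linarith+
      \<comment> \<open>Moving from u to u - k raises the displacement by k; \<open>d + k\<close>
        may be -1 or N + 1.\<close>
      have nbr: "g ((u - k) mod int N) = ennreal (cycle_hit N (d + k))"
        and nonneg: "0 \<le> cycle_hit N (d + k)" if k: "k \<in> {1, -1, 2, -2}" for k
      proof -
        have "(int l - (u - k) mod int N) mod int N = (d + k) mod int N"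
          unfolding d_def by (simp add: mod_simps algebra_simps)
        moreover have *: "cycle_hit N ((d + k) mod int N) = cycle_hit N (d + k)"
          using assms(1) d k by (intro cycle_hit_mod) auto
        ultimately show "g ((u - k) mod int N) = ennreal (cycle_hit N (d + k))"
          by (simp add: g_def)
        \<comment> \<open>\<open>ennreal\<close> sends negatives to 0, so the sum passes through it
          only with this sign, obtained at the reduced argument.\<close>
        show "0 \<le> cycle_hit N (d + k)"
          unfolding *[symmetric] using N by (intro cycle_hit_nonneg) (auto intro: less_imp_le)
      qed
      let ?s = "\<Sum>k\<in>{1, -1, 2, -2}. cycle_hit N (d + k)"
      have s: "?s \<ge> 0" using nonneg by (rule sum_nonneg)
      have "(\<Sum>k\<in>{1, -1, 2, -2}. g ((u - k) mod int N)) = ennreal ?s"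
        using nbr nonneg by (subst sum_ennreal[symmetric]) (auto intro!: sum.cong)
      then have "(\<integral>\<^sup>+v. g v \<partial>srw_step (cycle_square N) u) = ennreal ?s / 4"
        unfolding nn_integral_srw_step_cycle_square[OF assms(1) u(1)] by simp
      also have "\<dots> = ennreal (?s / 4)"
        using divide_ennreal[OF s, of 4] by simp
      finally have "1 + (\<integral>\<^sup>+v. g v \<partial>srw_step (cycle_square N) u) = ennreal (1 + ?s / 4)"
        using ennreal_plus[of 1 "?s / 4"] s by (simp only: ennreal_1 divide_nonneg_nonneg zero_le_one zero_le_numeral)
      also have "1 + ?s / 4 = cycle_hit N d"
        using cycle_hit_harmonic[OF d] by linarith
      finally show ?thesis by (simp add: g_def d_def)
    qed
  qed
  also have "g 0 = ennreal (cycle_hit N (int l))"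
    using l by (simp add: g_def)
  \<comment> \<open>As 0 <= l < N, no argument equals -1 and \<open>fib_int\<close> is the ordinary
    \<open>fib\<close>.\<close>
  finally show ?thesis
    using l by (simp add: cycle_hit_def fib_int_def nat_diff_distrib flip: of_nat_diff)
qed

end
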